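(* Let $\mathbb{F}$ be an arbitrary field, let $p\in\mathbb{F}[x]$ be a monic irreducible polynomial with $\deg(p)=s$, and let $G=\mathrm{diag}(G_1,\ldots,G_m)$ be a generalized Jordan matrix with blocks $G_i\in M_{s\alpha_i}(\mathbb{F})$, generalized Segre characteristic $\alpha=(\alpha_1,\ldots,\alpha_m)$, characteristic polynomial $p_G=p^r$ and minimal polynomial $m_G=p^{r_1}$, $r_1\le r$. If $X\in Z(G)$, then $X=[X_{i,j}]_{i,j=1,\ldots,m}$, where each $X_{i,j}\in M_{s\alpha_i\times s\alpha_j}(\mathbb{F})$ is a block lower triangular Toeplitz matrix (with respect to its partition into $s\times s$ blocks) of the following form: 1) If $\alpha_i=\alpha_j$, then $X_{i,j}\in Z(G_i)$. 2) If $\alpha_i<\alpha_j$, then $X_{i,j}=\begin{bmatrix} Y_{i,j} & 0\end{bmatrix}$ for some $Y_{i,j}\in Z(G_i)$. 3) If $\alpha_i>\alpha_j$, then $X_{i,j}=\begin{bmatrix} 0\\ Y_{i,j}\end{bmatrix}$ for some $Y_{i,j}\in Z(G_j)$.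
   Context: For a square matrix $A\in M_n(\mathbb{F})$, $Z(A)=\{B\in M_n(\mathbb{F}): AB=BA\}$ is the centralizer of $A$. Let $p=x^s+c_{s-1}x^{s-1}+\cdots+c_1x+c_0\in\mathbb{F}[x]$. Its companion matrix $C\in M_s(\mathbb{F})$ has ones on the first subdiagonal, last column $(-c_0,-c_1,\ldots,-c_{s-1})^T$, and zeros elsewhere. $E\in M_s(\mathbb{F})$ is the matrix whose only nonzero entry is a $1$ in position $(1,s)$. A generalized Jordan block $G_i\in M_{s\alpha_i}(\mathbb{F})$ is the $\alpha_i\times\alpha_i$ block matrix with $s\times s$ blocks having $C$ in every diagonal block, $E$ in every block of the first block subdiagonal, and $0$ elsewhere. A generalized Jordan matrix is $G=\mathrm{diag}(G_1,\ldots,G_m)$, all $G_i$ built from the same $p$, with $\alpha_1\ge\alpha_2\ge\cdots\ge\alpha_m\ge0$ and $\sum_i\alpha_i=r$; $\alpha=(\alpha_1,\ldots,\alpha_m)$ is its generalized Segre characteristic. A (possibly rectangular) block matrix $[T_{k,l}]$ with $s\times s$ blocks is block lower triangular Toeplitz if $T_{k,l}$ depends only on $k-l$ and $T_{k,l}=0$ whenever $l>k$. *)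

theory Defs
  imports
    "Jordan_Normal_Form.Char_Poly"
    "Jordan_Normal_Form.DL_Submatrix"
begin

text \<open>All indices are 0-based. Matrices with zero rows or columns are allowed (they occur
  when some \<open>\<alpha>\<^sub>i = 0\<close>).\<close>

text \<open>The following three definitions are intended for square \<open>A\<close> only.\<close>

definition centralizer :: "'a :: semiring_0 mat \<Rightarrow> 'a mat set" where
  "centralizer A = {B \<in> carrier_mat (dim_row A) (dim_row A). A * B = B * A}"

definition poly_mat :: "'a :: comm_ring_1 poly \<Rightarrow> 'a mat \<Rightarrow> 'a mat" where
  "poly_mat q A = mat (dim_row A) (dim_row A)
     (\<lambda>(i, j). \<Sum>k\<le>degree q. coeff q k * (A ^\<^sub>m k) $$ (i, j))"

definition is_minimal_poly :: "'a :: field mat \<Rightarrow> 'a poly \<Rightarrow> bool" where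
  "is_minimal_poly A q \<longleftrightarrow>
     lead_coeff q = 1 \<and> poly_mat q A = 0\<^sub>m (dim_row A) (dim_row A) \<and>
     (\<forall>h. h \<noteq> 0 \<and> poly_mat h A = 0\<^sub>m (dim_row A) (dim_row A) \<longrightarrow> degree q \<le> degree h)"

definition companion_mat :: "'a :: field poly \<Rightarrow> 'a mat" where
  "companion_mat p = (let s = degree p in mat s s
     (\<lambda>(i, j). if j = s - 1 then - coeff p i else if i = Suc j then 1 else 0))"

definition corner_mat :: "nat \<Rightarrow> 'a :: field mat" where
  "corner_mat s = mat s s (\<lambda>(i, j). if i = 0 \<and> j = s - 1 then 1 else 0)"

text \<open>The \<open>a \<times> b\<close> block matrix whose \<open>(k, l)\<close> block is the \<open>s \<times> s\<close> matrix \<open>T k l\<close>.\<close>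

definition mat_of_blocks ::
    "nat \<Rightarrow> nat \<Rightarrow> nat \<Rightarrow> (nat \<Rightarrow> nat \<Rightarrow> 'a mat) \<Rightarrow> 'a mat" where
  "mat_of_blocks s a b T = mat (s * a) (s * b)
     (\<lambda>(i, j). T (i div s) (j div s) $$ (i mod s, j mod s))"

definition gen_jordan_block :: "'a :: field poly \<Rightarrow> nat \<Rightarrow> 'a mat" where
  "gen_jordan_block p a = (let s = degree p in mat_of_blocks s a a
     (\<lambda>k l. if k = l then companion_mat p
            else if k = Suc l then corner_mat s
            else 0\<^sub>m s s))"

definition gen_jordan_mat :: "'a :: field poly \<Rightarrow> nat list \<Rightarrow> 'a mat" where
  "gen_jordan_mat p \<alpha> = diag_block_mat (map (gen_jordan_block p) \<alpha>)"

text \<open>The \<open>(k, l)\<close> block of \<open>A\<close> in its partition into \<open>s \<times> s\<close> blocks.\<close>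

definition uniform_block :: "nat \<Rightarrow> 'a mat \<Rightarrow> nat \<Rightarrow> nat \<Rightarrow> 'a mat" where
  "uniform_block s A k l = submatrix A {s * k..<s * Suc k} {s * l..<s * Suc l}"

text \<open>The \<open>(i, j)\<close> block of \<open>X\<close> when rows and columns are partitioned into consecutive
  groups of sizes \<open>s * \<alpha> ! 0, s * \<alpha> ! 1, \<dots>\<close>.\<close>

definition segre_block :: "nat \<Rightarrow> nat list \<Rightarrow> 'a mat \<Rightarrow> nat \<Rightarrow> nat \<Rightarrow> 'a mat" where
  "segre_block s \<alpha> X i j = submatrix X
     {s * sum_list (take i \<alpha>)..<s * sum_list (take (Suc i) \<alpha>)}
     {s * sum_list (take j \<alpha>)..<s * sum_list (take (Suc j) \<alpha>)}"

definition block_lower_triangular_toeplitz ::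
    "nat \<Rightarrow> nat \<Rightarrow> nat \<Rightarrow> 'a :: zero mat \<Rightarrow> bool" where
  "block_lower_triangular_toeplitz s a b A \<longleftrightarrow>
     A \<in> carrier_mat (s * a) (s * b) \<and>
     (\<forall>k < a. \<forall>l < b. \<forall>k' < a. \<forall>l' < b. int k - int l = int k' - int l' \<longrightarrow>
        uniform_block s A k l = uniform_block s A k' l') \<and>
     (\<forall>k < a. \<forall>l < b. k < l \<longrightarrow> uniform_block s A k l = 0\<^sub>m s s)"

text \<open>\<open>[A B]\<close>, the column analogue of \<open>append_rows\<close>.\<close>

definition append_cols :: "'a :: zero mat \<Rightarrow> 'a mat \<Rightarrow> 'a mat" (infixr "@\<^sub>c" 65) where
  "A @\<^sub>c B = four_block_mat A B (0\<^sub>m 0 (dim_col A)) (0\<^sub>m 0 (dim_col B))"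

end

theory Submission
  imports Defs
begin

text \<open>
  Write \<open>s = deg p\<close>. The generalized Jordan block \<open>G\<^sub>a\<close> with \<open>a\<close> diagonal blocks is the matrix of
  multiplication by \<open>x\<close> on \<open>F[x]/(p\<^sup>a)\<close> in the basis \<open>x\<^sup>j p\<^sup>k\<close> (\<open>j < s\<close>, \<open>k < a\<close>), where
  \<open>x\<^sup>j p\<^sup>k\<close> has index \<open>s * k + j\<close>. In this basis multiplication by \<open>p\<close> sends \<open>x\<^sup>j p\<^sup>k\<close> to
  \<open>x\<^sup>j p\<^bsup>k+1\<^esup>\<close>; that is, \<open>p(G\<^sub>a)\<close> is the block shift \<open>N\<^sub>a\<close>, which moves every block of rows
  down by one.

  Cutting \<open>X G = G X\<close> into blocks gives \<open>G\<^sub>i X\<^sub>i\<^sub>j = X\<^sub>i\<^sub>j G\<^sub>j\<close>, because \<open>G\<close> is block diagonal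
  (\<open>segre_block_intertwines\<close>). Any matrix that intertwines \<open>G\<^sub>b\<close> and \<open>G\<^sub>a\<close> also
  intertwines \<open>p(G\<^sub>b)\<close> and \<open>p(G\<^sub>a)\<close>, so \<open>N\<^sub>a X = X N\<^sub>b\<close> (\<open>intertwines_shift\<close>). Read block by block,
  this identity has three parts. In the interior it says that moving one block down and one block
  to the right changes nothing, which is the Toeplitz property. In the first block row it says that
  all blocks but the first vanish, so \<open>X\<close> is block lower triangular. In the last block column
  it says that all blocks but the bottom one vanish; along the diagonals this kills the top
  \<open>a - b\<close> block rows when \<open>b < a\<close>.

  Triangularity also kills the last \<open>b - a\<close> block columns when \<open>a < b\<close>. In either case the
  surviving square part commutes with the smaller block, since that block is both the
  leading and the trailing principal submatrix of the larger one, whose remaining entries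
  only meet zeros of \<open>X\<close>.
\<close>

section \<open>Polynomials in a matrix\<close>

lemma pow_mat_intertwine:
  fixes A B X :: "'a :: comm_ring_1 mat"
  assumes A: "A \<in> carrier_mat n n" and B: "B \<in> carrier_mat k k" and X: "X \<in> carrier_mat n k"
    and AX: "A * X = X * B"
  shows "A ^\<^sub>m d * X = X * B ^\<^sub>m d"
proof (induction d)
  case 0
  then show ?case using A B X by simp
next
  case (Suc d)
  have Ad: "A ^\<^sub>m d \<in> carrier_mat n n" and Bd: "B ^\<^sub>m d \<in> carrier_mat k k"
    using A B by simp_all
  have "A ^\<^sub>m Suc d * X = A ^\<^sub>m d * (A * X)"
    using assoc_mult_mat[OF Ad A X] by simp
  also have "\<dots> = (A ^\<^sub>m d * X) * B"
    using AX assoc_mult_mat[OF Ad X B] by simp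
  also have "\<dots> = X * B ^\<^sub>m Suc d"
    using Suc assoc_mult_mat[OF X Bd B] by simp
  finally show ?case .
qed

lemma mult_mat_index:
  assumes "A \<in> carrier_mat n k" "B \<in> carrier_mat k m" "i < n" "j < m"
  shows "(A * B) $$ (i, j) = (\<Sum>l=0..<k. A $$ (i, l) * B $$ (l, j))"
  using assms by (auto simp: scalar_prod_def intro!: sum.cong)

lemma poly_mat_carrier [simp]:
  "A \<in> carrier_mat n n \<Longrightarrow> poly_mat q A \<in> carrier_mat n n"
  "dim_row (poly_mat q A) = dim_row A"
  "dim_col (poly_mat q A) = dim_row A"
  by (simp_all add: poly_mat_def)

lemma mult_poly_mat_index:
  fixes M A :: "'a :: comm_ring_1 mat"
  assumes "A \<in> carrier_mat n n" "M \<in> carrier_mat k n" "i < k" "j < n"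
  shows "(M * poly_mat q A) $$ (i, j) = (\<Sum>d\<le>degree q. coeff q d * (M * A ^\<^sub>m d) $$ (i, j))"
proof -
  have "(M * poly_mat q A) $$ (i, j)
      = (\<Sum>l<n. M $$ (i, l) * (\<Sum>d\<le>degree q. coeff q d * (A ^\<^sub>m d) $$ (l, j)))"
    using assms by (auto simp: scalar_prod_def poly_mat_def lessThan_atLeast0 intro!: sum.cong)
  also have "\<dots> = (\<Sum>d\<le>degree q. coeff q d * (\<Sum>l<n. M $$ (i, l) * (A ^\<^sub>m d) $$ (l, j)))"
    unfolding sum_distrib_left by (subst sum.swap) (simp add: mult_ac)
  also have "\<dots> = (\<Sum>d\<le>degree q. coeff q d * (M * A ^\<^sub>m d) $$ (i, j))"
    using assms by (auto simp: scalar_prod_def lessThan_atLeast0 intro!: sum.cong)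
  finally show ?thesis .
qed

lemma poly_mat_mult_index:
  fixes M A :: "'a :: comm_ring_1 mat"
  assumes "A \<in> carrier_mat n n" "M \<in> carrier_mat n k" "i < n" "j < k"
  shows "(poly_mat q A * M) $$ (i, j) = (\<Sum>d\<le>degree q. coeff q d * (A ^\<^sub>m d * M) $$ (i, j))"
proof -
  have "(poly_mat q A * M) $$ (i, j)
      = (\<Sum>l<n. (\<Sum>d\<le>degree q. coeff q d * (A ^\<^sub>m d) $$ (i, l)) * M $$ (l, j))"
    using assms by (auto simp: scalar_prod_def poly_mat_def lessThan_atLeast0 intro!: sum.cong)
  also have "\<dots> = (\<Sum>d\<le>degree q. coeff q d * (\<Sum>l<n. (A ^\<^sub>m d) $$ (i, l) * M $$ (l, j)))"
    unfolding sum_distrib_left sum_distrib_right by (subst sum.swap) (simp add: mult_ac)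
  also have "\<dots> = (\<Sum>d\<le>degree q. coeff q d * (A ^\<^sub>m d * M) $$ (i, j))"
    using assms by (auto simp: scalar_prod_def lessThan_atLeast0 intro!: sum.cong)
  finally show ?thesis .
qed

lemma poly_mat_intertwine:
  fixes A B X :: "'a :: comm_ring_1 mat"
  assumes A: "A \<in> carrier_mat n n" and B: "B \<in> carrier_mat k k" and X: "X \<in> carrier_mat n k"
    and AX: "A * X = X * B"
  shows "poly_mat q A * X = X * poly_mat q B"
proof (rule eq_matI)
  fix i j assume "i < dim_row (X * poly_mat q B)" "j < dim_col (X * poly_mat q B)"
  then have ij: "i < n" "j < k" using X B by auto
  show "(poly_mat q A * X) $$ (i, j) = (X * poly_mat q B) $$ (i, j)"
    unfolding poly_mat_mult_index[OF A X ij] mult_poly_mat_index[OF B X ij]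
    by (simp add: pow_mat_intertwine[OF A B X AX])
qed (use A B X in auto)

section \<open>Contiguous submatrices\<close>

lemma pick_interval:
  assumes "a + i < b"
  shows "pick {a..<b} i = a + i"
  using assms
proof (induction i)
  case 0
  then show ?case by (auto intro!: Least_equality)
next
  case (Suc i)
  then show ?case by (auto intro!: Least_equality)
qed

lemma submatrix_interval:
  assumes "b \<le> dim_row A" "d \<le> dim_col A"
  shows "submatrix A {a..<b} {c..<d} = mat (b - a) (d - c) (\<lambda>(i, j). A $$ (a + i, c + j))"
proof -
  have "{i. i < dim_row A \<and> i \<in> {a..<b}} = {a..<b}" "{i. i < dim_col A \<and> i \<in> {c..<d}} = {c..<d}"
    using assms by auto
  then show ?thesis
    unfolding submatrix_def by (intro eq_matI) (simp_all add: pick_interval)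
qed

lemma uniform_block_eq:
  assumes "A \<in> carrier_mat (s * a) (s * b)" "k < a" "l < b"
  shows "uniform_block s A k l = mat s s (\<lambda>(u, v). A $$ (s * k + u, s * l + v))"
proof -
  have "s * Suc k \<le> dim_row A" "s * Suc l \<le> dim_col A"
    unfolding carrier_matD[OF assms(1)] using assms(2,3) by (simp_all del: mult_Suc_right)
  from submatrix_interval[OF this] show ?thesis
    unfolding uniform_block_def by simp
qed

section \<open>Generalized Jordan blocks\<close>

lemma gen_jordan_block_carrier [simp]:
  "gen_jordan_block p a \<in> carrier_mat (degree p * a) (degree p * a)"
  "dim_row (gen_jordan_block p a) = degree p * a"
  "dim_col (gen_jordan_block p a) = degree p * a"
  by (simp_all add: gen_jordan_block_def mat_of_blocks_def Let_def)

lemma block_index_less: "u < s \<Longrightarrow> k < a \<Longrightarrow> s * k + u < s * (a :: nat)"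
  by (metis add_less_cancel_left less_le_trans mult_Suc_right mult_le_mono2 Suc_leI add.commute)

text \<open>
  The entries of \<open>C\<close> and \<open>E\<close> fit together: the subdiagonal ones of \<open>C\<close> and the corner ones of \<open>E\<close>
  make up the whole first subdiagonal of the block, and everything else comes from the last
  columns of the copies of \<open>C\<close>.
\<close>

lemma gen_jordan_block_index:
  assumes "u < degree p" "v < degree p" "k < a" "l < a"
  shows "gen_jordan_block p a $$ (degree p * k + u, degree p * l + v)
    = (if degree p * k + u = Suc (degree p * l + v) then 1 else 0)
      - (if k = l \<and> Suc v = degree p then coeff p u else 0)"
proof -
  define s where "s = degree p"
  have s: "u < s" "v < s" using assms by (auto simp: s_def)
  have div_mod: "(s * k' + u') div s = k'" "(s * k' + u') mod s = u'" if "u' < s" for k' u'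
    using that by auto
  have blocks: "s * k + u = s * k' + u' \<longleftrightarrow> k = k' \<and> u = u'" if "u' < s" for k' u'
  proof
    assume "s * k + u = s * k' + u'"
    then have "(s * k + u) div s = (s * k' + u') div s" "(s * k + u) mod s = (s * k' + u') mod s"
      by (rule arg_cong)+
    then show "k = k' \<and> u = u'" unfolding div_mod[OF s(1)] div_mod[OF that] by (rule conjI)
  qed (simp only:)
  have eq: "s * k + u = Suc (s * l + v) \<longleftrightarrow>
      (if Suc v = s then k = Suc l \<and> u = 0 else k = l \<and> u = Suc v)"
  proof (cases "Suc v = s")
    case True
    then have "Suc (s * l + v) = s * Suc l + 0" by simp
    moreover have "0 < s" using s by linarith
    ultimately show ?thesis using True blocks[of 0 "Suc l"] by (simp only: if_True simp_thms)
  next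
    case False
    then have "Suc v < s" using s by linarith
    from blocks[OF this, of l] False show ?thesis by (simp only: if_False add_Suc_right)
  qed
  have "gen_jordan_block p a $$ (s * k + u, s * l + v)
      = (if k = l then companion_mat p else if k = Suc l then corner_mat s else 0\<^sub>m s s) $$ (u, v)"
    using block_index_less[OF s(1) assms(3)] block_index_less[OF s(2) assms(4)]
      div_mod[OF s(1), of k] div_mod[OF s(2), of l]
    by (simp add: gen_jordan_block_def mat_of_blocks_def Let_def s_def)
  also have "\<dots> = (if s * k + u = Suc (s * l + v) then 1 else 0)
      - (if k = l \<and> Suc v = s then coeff p u else 0)"
  proof -
    have last: "v = s - 1 \<longleftrightarrow> Suc v = s" using s by arith
    have C: "companion_mat p $$ (u, v) = (if Suc v = s then - coeff p u else if u = Suc v then 1 else 0)"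
      using s unfolding companion_mat_def Let_def s_def[symmetric] last[symmetric] by simp
    have E: "corner_mat s $$ (u, v) = (if u = 0 \<and> Suc v = s then 1 else 0)"
      using s unfolding corner_mat_def last[symmetric] by simp
    have Z: "0\<^sub>m s s $$ (u, v) = 0" using s by simp
    have "u \<noteq> s" using s by simp
    then show ?thesis unfolding eq
      by (cases "k = l"; cases "k = Suc l"; cases "Suc v = s")
        (simp_all only: C E Z if_True if_False simp_thms diff_0 diff_0_right n_not_Suc_n)
  qed
  finally show ?thesis unfolding s_def .
qed

lemma sum_blocks:
  fixes f :: "nat \<Rightarrow> 'b :: comm_monoid_add"
  shows "(\<Sum>j<s * a. f j) = (\<Sum>k<a. \<Sum>u<s. f (s * k + u))"
proof (induction a)
  case (Suc a)
  have "(\<Sum>j<s * Suc a. f j) = (\<Sum>j<s * a. f j) + (\<Sum>j=s * a..<s * a + s. f j)"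
    by (simp add: add.commute lessThan_atLeast0 sum.atLeastLessThan_concat)
  also have "(\<Sum>j=s * a..<s * a + s. f j) = (\<Sum>u<s. f (s * a + u))"
    using sum.shift_bounds_nat_ivl[of f 0 "s * a" s]
    by (simp add: lessThan_atLeast0 add.commute)
  finally show ?case using Suc by simp
qed simp

text \<open>
  For \<open>v + 1 < s\<close> this is \<open>x \<cdot> x\<^sup>v p\<^sup>l = x\<^bsup>v+1\<^esup> p\<^sup>l\<close>; at the end of a block it is
  \<open>x \<cdot> x\<^bsup>s-1\<^esup> p\<^sup>l = p\<^bsup>l+1\<^esup> - (c\<^sub>0 + \<dots> + c\<^bsub>s-1\<^esub> x\<^bsup>s-1\<^esup>) p\<^sup>l\<close>. The value \<open>0\<close> past the last column is
  the relation \<open>p\<^sup>a = 0\<close>. With a general left factor \<open>M\<close> the lemma can be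
  iterated to compute \<open>M G\<^sup>v\<close>.
\<close>

lemma mult_gen_jordan_block_index:
  fixes p :: "'a :: field poly"
  assumes M: "M \<in> carrier_mat n (degree p * a)" and i: "i < n" and l: "l < a" and v: "v < degree p"
  shows "(M * gen_jordan_block p a) $$ (i, degree p * l + v)
    = (if Suc (degree p * l + v) < degree p * a then M $$ (i, Suc (degree p * l + v)) else 0)
      - (if Suc v = degree p then \<Sum>u<degree p. coeff p u * M $$ (i, degree p * l + u) else 0)"
    (is "_ = ?r1 - ?r2")
proof -
  define s where "s = degree p"
  let ?c = "s * l + v"
  have c: "?c < s * a" using block_index_less[of v s l a] l v by (simp add: s_def)
  have "(M * gen_jordan_block p a) $$ (i, ?c)
      = (\<Sum>j<s * a. M $$ (i, j) * gen_jordan_block p a $$ (j, ?c))"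
    using M i c by (auto simp: scalar_prod_def s_def lessThan_atLeast0 intro!: sum.cong)
  also have "\<dots> = (\<Sum>k<a. \<Sum>u<s. M $$ (i, s * k + u) * (if s * k + u = Suc ?c then 1 else 0)
      - M $$ (i, s * k + u) * (if k = l \<and> Suc v = s then coeff p u else 0))"
    unfolding sum_blocks using l v
    by (intro sum.cong refl) (simp add: gen_jordan_block_index s_def right_diff_distrib)
  also have "\<dots> = (\<Sum>j<s * a. M $$ (i, j) * (if j = Suc ?c then 1 else 0))
      - (\<Sum>k<a. \<Sum>u<s. M $$ (i, s * k + u) * (if k = l \<and> Suc v = s then coeff p u else 0))"
    unfolding sum_blocks by (simp add: sum_subtractf)
  also have "(\<Sum>j<s * a. M $$ (i, j) * (if j = Suc ?c then 1 else 0)) = ?r1"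
    by (simp add: s_def if_distrib cong: if_cong)
  also have "(\<Sum>k<a. \<Sum>u<s. M $$ (i, s * k + u) * (if k = l \<and> Suc v = s then coeff p u else 0))
      = (\<Sum>k<a. if k = l then (\<Sum>u<s. M $$ (i, s * k + u) * (if Suc v = s then coeff p u else 0)) else 0)"
    by (intro sum.cong refl) auto
  also have "\<dots> = ?r2"
    using l by (simp add: s_def mult.commute)
  finally show ?thesis unfolding s_def .
qed

lemma mult_gen_jordan_block_pow_index:
  fixes p :: "'a :: field poly"
  assumes M: "M \<in> carrier_mat n (degree p * a)" and i: "i < n" and l: "l < a"
    and "w + v < degree p"
  shows "(M * gen_jordan_block p a ^\<^sub>m v) $$ (i, degree p * l + w) = M $$ (i, degree p * l + (w + v))"
  using assms(4)
proof (induction v arbitrary: w)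
  case 0
  then show ?case using M by simp
next
  case (Suc v)
  let ?G = "gen_jordan_block p a"
  have Gv: "?G ^\<^sub>m v \<in> carrier_mat (degree p * a) (degree p * a)" by simp
  have "M * ?G ^\<^sub>m Suc v = (M * ?G ^\<^sub>m v) * ?G"
    using assoc_mult_mat[OF M Gv, of ?G "degree p * a"] by simp
  moreover have "(\<dots>) $$ (i, degree p * l + w) = (M * ?G ^\<^sub>m v) $$ (i, degree p * l + Suc w)"
    using Suc.prems block_index_less[of "Suc w" "degree p" l a] l M
    by (subst mult_gen_jordan_block_index[of _ n, OF _ i l]) auto
  ultimately show ?case using Suc.IH[of "Suc w"] Suc.prems by simp
qed

text \<open>
  Right multiplication by \<open>p(G)\<close> shifts the block columns to the left. For the first column of a block
  this is the previous lemmas, with the coefficients of \<open>p\<close> cancelling those produced by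
  \<open>G\<^sup>s\<close>; the other columns follow because \<open>p(G)\<close> commutes with \<open>G\<^sup>v\<close>, which carries
  column \<open>0\<close> of a block to column \<open>v\<close>.
\<close>

lemma mult_poly_mat_gen_jordan_block_index:
  fixes p :: "'a :: field poly"
  assumes p: "lead_coeff p = 1" and M: "M \<in> carrier_mat n (degree p * a)"
    and i: "i < n" and l: "l < a" and v: "v < degree p"
  shows "(M * poly_mat p (gen_jordan_block p a)) $$ (i, degree p * l + v)
    = (if Suc l < a then M $$ (i, degree p * Suc l + v) else 0)"
proof -
  let ?G = "gen_jordan_block p a" and ?s = "degree p"
  let ?P = "poly_mat p ?G"
  have G: "?G \<in> carrier_mat (?s * a) (?s * a)" by simp
  have P: "?P \<in> carrier_mat (?s * a) (?s * a)" by simp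
  have s0: "0 < ?s" using v by simp
  have less: "?s * l + u < ?s * a" if "u < ?s" for u using block_index_less that l by blast
  \<comment> \<open>Stated for all \<open>K\<close>, since it is applied to \<open>M * G\<^sup>v\<close> below.\<close>
  have first: "(K * ?P) $$ (i, ?s * l) = (if Suc l < a then K $$ (i, ?s * Suc l) else 0)"
    if K: "K \<in> carrier_mat n (?s * a)" for K
  proof -
    obtain t where t: "?s = Suc t" using s0 gr0_conv_Suc by blast
    have Gt: "?G ^\<^sub>m t \<in> carrier_mat (?s * a) (?s * a)" by simp
    have KG: "K * ?G \<in> carrier_mat n (?s * a)" using K by simp
    have "K * ?G ^\<^sub>m ?s = (K * ?G) * ?G ^\<^sub>m t"
      using assoc_mult_mat[OF K G Gt] pow_mat_intertwine[OF G G G refl, of t] t by simp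
    then have "(K * ?G ^\<^sub>m ?s) $$ (i, ?s * l) = (K * ?G) $$ (i, ?s * l + t)"
      using mult_gen_jordan_block_pow_index[OF KG i l, of 0 t] t by simp
    also have "\<dots> = (if Suc l < a then K $$ (i, ?s * Suc l) else 0)
        - (\<Sum>u<?s. coeff p u * K $$ (i, ?s * l + u))"
    proof -
      have idx: "Suc (?s * l + t) = ?s * Suc l" using t by simp
      have lt: "?s * Suc l < ?s * a \<longleftrightarrow> Suc l < a" using s0 mult_less_cancel1 by blast
      have "t < ?s" using t by simp
      from mult_gen_jordan_block_index[OF K i l this] show ?thesis
        unfolding idx lt t[symmetric] by (simp only: simp_thms if_True)
    qed
    finally have top: "(K * ?G ^\<^sub>m ?s) $$ (i, ?s * l) = \<dots>" .
    have "(K * ?P) $$ (i, ?s * l)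
        = (\<Sum>d<?s. coeff p d * (K * ?G ^\<^sub>m d) $$ (i, ?s * l)) + (K * ?G ^\<^sub>m ?s) $$ (i, ?s * l)"
      using mult_poly_mat_index[OF G K i, of "?s * l"] less[OF s0] p
      by (simp add: lessThan_Suc_atMost[symmetric])
    also have "(\<Sum>d<?s. coeff p d * (K * ?G ^\<^sub>m d) $$ (i, ?s * l))
        = (\<Sum>d<?s. coeff p d * K $$ (i, ?s * l + d))"
      using mult_gen_jordan_block_pow_index[OF K i l, of 0] by (intro sum.cong) auto
    finally show ?thesis using top by simp
  qed
  have Gv: "?G ^\<^sub>m v \<in> carrier_mat (?s * a) (?s * a)" by simp
  have "(M * ?P) $$ (i, ?s * l + v) = ((M * ?P) * ?G ^\<^sub>m v) $$ (i, ?s * l)"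
    using mult_gen_jordan_block_pow_index[OF mult_carrier_mat[OF M P] i l, of 0 v] v
    by (simp del: index_mult_mat)
  also have "(M * ?P) * ?G ^\<^sub>m v = (M * ?G ^\<^sub>m v) * ?P"
    using assoc_mult_mat[OF M P Gv] assoc_mult_mat[OF M Gv P]
      poly_mat_intertwine[OF G G Gv, of p] pow_mat_intertwine[OF G G G refl, of v] by simp
  also have "\<dots> $$ (i, ?s * l) = (if Suc l < a then (M * ?G ^\<^sub>m v) $$ (i, ?s * Suc l) else 0)"
    using first[of "M * ?G ^\<^sub>m v"] M Gv by simp
  also have "\<dots> = (if Suc l < a then M $$ (i, ?s * Suc l + v) else 0)"
    using mult_gen_jordan_block_pow_index[OF M i, of "Suc l" 0 v] v by simp
  finally show ?thesis .
qed

text \<open>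
  The same shift seen from the left: taking \<open>M = 1\<close> in the previous lemma gives the entries of \<open>p(G)\<close>,
  so that left multiplication moves the block rows down.
\<close>

lemma poly_mat_gen_jordan_block_mult_index:
  fixes p :: "'a :: field poly"
  assumes p: "lead_coeff p = 1" and M: "M \<in> carrier_mat (degree p * a) n"
    and j: "j < n" and k: "k < a" and u: "u < degree p"
  shows "(poly_mat p (gen_jordan_block p a) * M) $$ (degree p * k + u, j)
    = (if k = 0 then 0 else M $$ (degree p * (k - 1) + u, j))"
proof -
  let ?G = "gen_jordan_block p a" and ?s = "degree p"
  let ?P = "poly_mat p ?G" and ?r = "degree p * k + u"
  have P: "?P \<in> carrier_mat (?s * a) (?s * a)" by simp
  have r: "?r < ?s * a" using block_index_less u k by blast
  have ent: "?P $$ (?r, ?s * l + v) = (if ?r = ?s * Suc l + v then 1 else 0)"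
    if "l < a" "v < ?s" for l v
  proof -
    have eq: "1\<^sub>m (?s * a) * ?P = ?P" using P by (rule left_mult_one_mat)
    have "Suc l < a" if "?r = ?s * Suc l + v"
    proof -
      have "?s * Suc l < ?s * a" using that r by linarith
      then show ?thesis by (simp only: mult_less_cancel1)
    qed
    moreover have "?s * Suc l + v < ?s * a" if "Suc l < a"
      using that block_index_less \<open>v < ?s\<close> by blast
    ultimately show ?thesis
      using mult_poly_mat_gen_jordan_block_index[OF p, of "1\<^sub>m (?s * a)" "?s * a" a ?r l v] r that P
      unfolding eq by auto
  qed
  have "(?P * M) $$ (?r, j) = (\<Sum>c<?s * a. ?P $$ (?r, c) * M $$ (c, j))"
    using M P r j by (auto simp: scalar_prod_def lessThan_atLeast0 intro!: sum.cong)
  also have "\<dots> = (\<Sum>c<?s * a. if c + ?s = ?r then M $$ (c, j) else 0)"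
    unfolding sum_blocks
  proof (intro sum.cong refl)
    fix l v assume "l \<in> {..<a}" "v \<in> {..<?s}"
    then show "?P $$ (?r, ?s * l + v) * M $$ (?s * l + v, j)
        = (if ?s * l + v + ?s = ?r then M $$ (?s * l + v, j) else 0)"
      using ent[of l v] by (auto simp: algebra_simps)
  qed
  also have "\<dots> = (if k = 0 then 0 else M $$ (degree p * (k - 1) + u, j))"
  proof (cases k)
    case 0
    then have "c + ?s \<noteq> ?r" for c using u by simp
    then show ?thesis using 0 by simp
  next
    case (Suc k')
    have "(c + ?s = ?r) = (c = ?s * k' + u)" for c using Suc by auto
    moreover have "?s * k' + u < ?s * a" using r Suc by auto
    ultimately show ?thesis using Suc by simp
  qed
  finally show ?thesis .
qed

section \<open>Intertwiners of two generalized Jordan blocks\<close>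

text \<open>
  In coordinates, these are the \<open>F[x]\<close>-linear maps from \<open>F[x]/(p\<^sup>b)\<close> to \<open>F[x]/(p\<^sup>a)\<close>.
\<close>

definition intertwines :: "'a :: field poly \<Rightarrow> nat \<Rightarrow> nat \<Rightarrow> 'a mat \<Rightarrow> bool" where
  "intertwines p a b X \<longleftrightarrow> X \<in> carrier_mat (degree p * a) (degree p * b) \<and>
     gen_jordan_block p a * X = X * gen_jordan_block p b"

lemma centralizer_gen_jordan_block_iff:
  "Y \<in> centralizer (gen_jordan_block p a) \<longleftrightarrow> intertwines p a a Y"
  unfolding centralizer_def intertwines_def gen_jordan_block_carrier(2) by blast

text \<open>
  The identity \<open>p(G\<^sub>a) X = X p(G\<^sub>b)\<close>, with both sides evaluated as block shifts. All of the shape of \<open>X\<close>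
  is read off from it.
\<close>

lemma intertwines_shift:
  fixes p :: "'a :: field poly"
  assumes p: "lead_coeff p = 1" and X: "intertwines p a b X"
    and "k < a" "l < b" "u < degree p" "v < degree p"
  shows "(if k = 0 then 0 else X $$ (degree p * (k - 1) + u, degree p * l + v))
    = (if Suc l < b then X $$ (degree p * k + u, degree p * Suc l + v) else 0)"
proof -
  have Xc: "X \<in> carrier_mat (degree p * a) (degree p * b)"
    and eq: "gen_jordan_block p a * X = X * gen_jordan_block p b"
    using X by (auto simp: intertwines_def)
  show ?thesis
    using poly_mat_gen_jordan_block_mult_index[OF p Xc block_index_less[OF assms(6,4)] assms(3,5)]
      mult_poly_mat_gen_jordan_block_index[OF p Xc block_index_less[OF assms(5,3)] assms(4,6)]
      poly_mat_intertwine[OF _ _ Xc eq, of p]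
    by simp
qed

lemma intertwines_Toeplitz:
  fixes p :: "'a :: field poly"
  assumes p: "lead_coeff p = 1" and X: "intertwines p a b X"
    and "k + d < a" "l + d < b" "u < degree p" "v < degree p"
  shows "X $$ (degree p * (k + d) + u, degree p * (l + d) + v) = X $$ (degree p * k + u, degree p * l + v)"
  using assms(3,4)
proof (induction d)
  case (Suc d)
  then show ?case
    using intertwines_shift[OF p X, of "k + Suc d" "l + d" u v] assms(5,6) by simp
qed simp

text \<open>
  Going up the diagonal reaches block row \<open>0\<close> in a column other than the first, where the shift identity
  leaves nothing on its left side.
\<close>

lemma intertwines_lower_triangular:
  fixes p :: "'a :: field poly"
  assumes p: "lead_coeff p = 1" and X: "intertwines p a b X"
    and "k < l" "k < a" "l < b" "u < degree p" "v < degree p"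
  shows "X $$ (degree p * k + u, degree p * l + v) = 0"
proof -
  obtain l' where l: "l = l' + k" "0 < l'" using assms(3) by (metis less_imp_add_positive add.commute)
  have "X $$ (degree p * k + u, degree p * l + v) = X $$ (degree p * 0 + u, degree p * l' + v)"
    using intertwines_Toeplitz[OF p X, of 0 k l' u v] assms l by simp
  also have "\<dots> = 0"
    using intertwines_shift[OF p X, of 0 "l' - 1" u v] assms l by simp
  finally show ?thesis .
qed

text \<open>
  Going down the diagonal reaches the last block column strictly above the bottom block row, where
  the shift identity leaves nothing on its right side.
\<close>

lemma intertwines_zero_above_bottom:
  fixes p :: "'a :: field poly"
  assumes p: "lead_coeff p = 1" and X: "intertwines p a b X"
    and "k + b < l + a" "k < a" "l < b" "u < degree p" "v < degree p"
  shows "X $$ (degree p * k + u, degree p * l + v) = 0"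
proof -
  define d where "d = b - 1 - l"
  have d: "l + d = b - 1" "Suc (k + d) < a" using assms by (auto simp: d_def)
  have "X $$ (degree p * k + u, degree p * l + v)
      = X $$ (degree p * (k + d) + u, degree p * (b - 1) + v)"
    using intertwines_Toeplitz[OF p X, of k d l u v] assms d by simp
  also have "\<dots> = 0"
    using intertwines_shift[OF p X, of "Suc (k + d)" "b - 1" u v] assms d by simp
  finally show ?thesis .
qed

lemma intertwines_block_lower_triangular_toeplitz:
  fixes p :: "'a :: field poly"
  assumes p: "lead_coeff p = 1" and X: "intertwines p a b X"
  shows "block_lower_triangular_toeplitz (degree p) a b X"
proof -
  have Xc: "X \<in> carrier_mat (degree p * a) (degree p * b)" using X by (simp add: intertwines_def)
  note ub = uniform_block_eq[OF Xc]
  have shift: "uniform_block (degree p) X k l = uniform_block (degree p) X k' l'"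
    if "k \<le> k'" "k < a" "l < b" "k' < a" "l' < b" "int k - int l = int k' - int l'" for k l k' l'
  proof -
    define d where "d = k' - k"
    have d: "k' = k + d" "l' = l + d" using that by (simp_all add: d_def)
    show ?thesis
      unfolding ub[OF that(2,3)] ub[OF that(4,5)]
    proof (rule cong_mat[OF refl refl])
      fix u v assume "u < degree p" "v < degree p"
      from intertwines_Toeplitz[OF p X that(4,5)[unfolded d] this]
      show "(case (u, v) of (u, v) \<Rightarrow> X $$ (degree p * k + u, degree p * l + v))
          = (case (u, v) of (u, v) \<Rightarrow> X $$ (degree p * k' + u, degree p * l' + v))"
        unfolding d prod.case by (rule sym)
    qed
  qed
  have const: "uniform_block (degree p) X k l = uniform_block (degree p) X k' l'"
    if "k < a" "l < b" "k' < a" "l' < b" "int k - int l = int k' - int l'" for k l k' l'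
  proof (cases "k \<le> k'")
    case True
    then show ?thesis using that by (rule shift)
  next
    case False
    then have "k' \<le> k" by simp
    from shift[OF this that(3,4,1,2) that(5)[symmetric]] show ?thesis by (rule sym)
  qed
  have upper: "uniform_block (degree p) X k l = 0\<^sub>m (degree p) (degree p)"
    if "k < a" "l < b" "k < l" for k l
    unfolding ub[OF that(1,2)] zero_mat_def
    by (rule cong_mat[OF refl refl])
      (simp add: intertwines_lower_triangular[OF p X that(3,1,2)])
  show ?thesis
    unfolding block_lower_triangular_toeplitz_def
    by (intro conjI allI impI Xc const upper)
qed

text \<open>
  The columns from \<open>s a\<close> on vanish by triangularity. The first \<open>s a\<close> columns of \<open>X G\<^sub>b\<close> agree with \<open>Y G\<^sub>a\<close>,
  because the one entry by which the column recurrences differ, in column \<open>s a\<close>, is zero.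
\<close>

lemma intertwines_wide:
  fixes p :: "'a :: field poly"
  assumes p: "lead_coeff p = 1" and s: "0 < degree p" and X: "intertwines p a b X" and ab: "a < b"
  shows "\<exists>Y \<in> centralizer (gen_jordan_block p a).
    X = Y @\<^sub>c 0\<^sub>m (degree p * a) (degree p * (b - a))"
proof
  let ?s = "degree p"
  define Y where "Y = mat (?s * a) (?s * a) (\<lambda>(i, j). X $$ (i, j))"
  have Xc: "X \<in> carrier_mat (?s * a) (?s * b)"
    and eq: "gen_jordan_block p a * X = X * gen_jordan_block p b"
    using X by (auto simp: intertwines_def)
  have Yc: "Y \<in> carrier_mat (?s * a) (?s * a)" by (simp add: Y_def)
  have le: "?s * a \<le> ?s * b" using ab by simp
  have zero: "X $$ (i, j) = 0" if "i < ?s * a" "?s * a \<le> j" "j < ?s * b" for i j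
  proof -
    have "i div ?s < a" using that(1) s by (simp add: less_mult_imp_div_less mult.commute)
    moreover have "j div ?s < b" using that(3) s by (simp add: less_mult_imp_div_less mult.commute)
    moreover have "a \<le> j div ?s" using that(2) s by (simp add: less_eq_div_iff_mult_less_eq mult.commute)
    ultimately show ?thesis
      using intertwines_lower_triangular[OF p X, of "i div ?s" "j div ?s" "i mod ?s" "j mod ?s"] s
      by simp
  qed
  show "X = Y @\<^sub>c 0\<^sub>m (?s * a) (?s * (b - a))"
  proof (rule eq_matI)
    show "dim_col X = dim_col (Y @\<^sub>c 0\<^sub>m (?s * a) (?s * (b - a)))"
      using Xc Yc le by (simp add: append_cols_def diff_mult_distrib2)
    fix i j
    assume "i < dim_row (Y @\<^sub>c 0\<^sub>m (?s * a) (?s * (b - a)))"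
      "j < dim_col (Y @\<^sub>c 0\<^sub>m (?s * a) (?s * (b - a)))"
    then have "i < ?s * a" "j < ?s * b"
      using Yc le by (auto simp: append_cols_def diff_mult_distrib2)
    then show "X $$ (i, j) = (Y @\<^sub>c 0\<^sub>m (?s * a) (?s * (b - a))) $$ (i, j)"
      using zero[of i j] le by (auto simp: append_cols_def Y_def diff_mult_distrib2)
  qed (use Xc Yc in \<open>auto simp: append_cols_def\<close>)
  have "gen_jordan_block p a * Y = Y * gen_jordan_block p a"
  proof (rule eq_matI)
    fix i j assume "i < dim_row (Y * gen_jordan_block p a)" "j < dim_col (Y * gen_jordan_block p a)"
    then have i: "i < ?s * a" and j: "j < ?s * a" using Yc by auto
    define l where "l = j div ?s"
    define v where "v = j mod ?s"
    have l: "l < a" using j s by (simp add: l_def less_mult_imp_div_less mult.commute)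
    have v: "v < ?s" using s by (simp add: v_def)
    have jlv: "j = ?s * l + v" by (simp add: l_def v_def)
    have "(gen_jordan_block p a * Y) $$ (i, j) = (gen_jordan_block p a * X) $$ (i, j)"
      unfolding mult_mat_index[OF gen_jordan_block_carrier(1) Yc i j]
        mult_mat_index[OF gen_jordan_block_carrier(1) Xc i less_le_trans[OF j le]]
      using j by (intro sum.cong) (auto simp: Y_def)
    also have "\<dots> = (X * gen_jordan_block p b) $$ (i, j)" by (simp add: eq)
    also have "\<dots> = (Y * gen_jordan_block p a) $$ (i, j)"
    proof -
      have "l < b" using l ab by simp
      have next_col: "(if Suc j < ?s * b then X $$ (i, Suc j) else 0)
          = (if Suc j < ?s * a then Y $$ (i, Suc j) else 0)"
      proof (cases "Suc j < ?s * a")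
        case True
        then show ?thesis using i less_le_trans[OF True le] by (simp add: Y_def)
      next
        case False
        then show ?thesis using zero[OF i, of "Suc j"] by simp
      qed
      have "X $$ (i, ?s * l + u) = Y $$ (i, ?s * l + u)" if "u < ?s" for u
        using i block_index_less[OF that l] by (simp add: Y_def)
      then have "(\<Sum>u<?s. coeff p u * X $$ (i, ?s * l + u))
          = (\<Sum>u<?s. coeff p u * Y $$ (i, ?s * l + u))"
        by (intro sum.cong) simp_all
      with next_col show ?thesis
        unfolding jlv mult_gen_jordan_block_index[OF Xc i \<open>l < b\<close> v]
          mult_gen_jordan_block_index[OF Yc i l v] by (simp only:)
    qed
    finally show "(gen_jordan_block p a * Y) $$ (i, j) = (Y * gen_jordan_block p a) $$ (i, j)" .
  qed (use Yc in auto)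
  with Yc show "Y \<in> centralizer (gen_jordan_block p a)"
    unfolding centralizer_gen_jordan_block_iff intertwines_def by (rule conjI)
qed

text \<open>
  The top \<open>s (a - b)\<close> rows of \<open>X\<close> vanish, so the bottom rows of \<open>G\<^sub>a X\<close> only involve the trailing principal
  submatrix of \<open>G\<^sub>a\<close>, which is \<open>G\<^sub>b\<close>.
\<close>

lemma intertwines_tall:
  fixes p :: "'a :: field poly"
  assumes p: "lead_coeff p = 1" and s: "0 < degree p" and X: "intertwines p a b X" and ab: "b < a"
  shows "\<exists>Y \<in> centralizer (gen_jordan_block p b).
    X = 0\<^sub>m (degree p * (a - b)) (degree p * b) @\<^sub>r Y"
proof
  let ?s = "degree p"
  define d where "d = ?s * (a - b)"
  define Y where "Y = mat (?s * b) (?s * b) (\<lambda>(i, j). X $$ (d + i, j))"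
  have Xc: "X \<in> carrier_mat (?s * a) (?s * b)"
    and eq: "gen_jordan_block p a * X = X * gen_jordan_block p b"
    using X by (auto simp: intertwines_def)
  have Yc: "Y \<in> carrier_mat (?s * b) (?s * b)" by (simp add: Y_def)
  have d: "?s * a = d + ?s * b" using ab by (simp add: d_def diff_mult_distrib2)
  have zero: "X $$ (i, j) = 0" if "i < d" "j < ?s * b" for i j
  proof -
    have "i div ?s < a - b" using that(1) s by (simp add: d_def less_mult_imp_div_less mult.commute)
    moreover have "j div ?s < b" using that(2) s by (simp add: less_mult_imp_div_less mult.commute)
    ultimately show ?thesis
      using intertwines_zero_above_bottom[OF p X, of "i div ?s" "j div ?s" "i mod ?s" "j mod ?s"] s
      by simp
  qed
  show "X = 0\<^sub>m (?s * (a - b)) (?s * b) @\<^sub>r Y"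
    unfolding d_def[symmetric]
  proof (rule eq_matI)
    fix i j
    assume "i < dim_row (0\<^sub>m d (?s * b) @\<^sub>r Y)" "j < dim_col (0\<^sub>m d (?s * b) @\<^sub>r Y)"
    then have "i < d + ?s * b" "j < ?s * b"
      using Yc by (auto simp: append_rows_def)
    then show "X $$ (i, j) = (0\<^sub>m d (?s * b) @\<^sub>r Y) $$ (i, j)"
      using zero[of i j] by (auto simp: append_rows_def Y_def)
  qed (use Xc Yc d in \<open>auto simp: append_rows_def\<close>)
  \<comment> \<open>The trailing principal submatrix of the larger block is the smaller block.\<close>
  have ent: "gen_jordan_block p a $$ (d + i, d + j) = gen_jordan_block p b $$ (i, j)"
    if ij: "i < ?s * b" "j < ?s * b" for i j
  proof -
    define k u l v where "k = i div ?s" and "u = i mod ?s" and "l = j div ?s" and "v = j mod ?s"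
    have kl: "k < b" "l < b"
      using ij s by (simp_all add: k_def l_def less_mult_imp_div_less mult.commute)
    have uv: "u < ?s" "v < ?s" using s by (simp_all add: u_def v_def)
    have i: "i = ?s * k + u" and j: "j = ?s * l + v" by (simp_all add: k_def u_def l_def v_def)
    have di: "d + i = ?s * (a - b + k) + u" and dj: "d + j = ?s * (a - b + l) + v"
      by (simp_all add: d_def i j add_mult_distrib2)
    have "?s * (a - b + k) + u = Suc (?s * (a - b + l) + v) \<longleftrightarrow> ?s * k + u = Suc (?s * l + v)"
      by (simp add: add_mult_distrib2)
    moreover have "a - b + k < a" "a - b + l < a" using kl ab by auto
    ultimately show ?thesis
      unfolding di dj unfolding i j by (simp add: gen_jordan_block_index uv kl)
  qed
  have "gen_jordan_block p b * Y = Y * gen_jordan_block p b"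
  proof (rule eq_matI)
    fix i j assume "i < dim_row (Y * gen_jordan_block p b)" "j < dim_col (Y * gen_jordan_block p b)"
    then have i: "i < ?s * b" and j: "j < ?s * b" using Yc by auto
    have di: "d + i < ?s * a" using i d by simp
    have "(Y * gen_jordan_block p b) $$ (i, j) = (X * gen_jordan_block p b) $$ (d + i, j)"
      using i j di Xc by (auto simp: scalar_prod_def Y_def intro!: sum.cong)
    also have "\<dots> = (gen_jordan_block p a * X) $$ (d + i, j)" by (simp add: eq)
    also have "\<dots> = (\<Sum>c=0..<d + ?s * b. gen_jordan_block p a $$ (d + i, c) * X $$ (c, j))"
      using di j Xc unfolding d[symmetric] by (auto simp: scalar_prod_def intro!: sum.cong)
    also have "\<dots> = (\<Sum>c=d..<d + ?s * b. gen_jordan_block p a $$ (d + i, c) * X $$ (c, j))"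
      using zero j by (intro sum.mono_neutral_right) auto
    also have "\<dots> = (\<Sum>c=0..<?s * b. gen_jordan_block p a $$ (d + i, d + c) * X $$ (d + c, j))"
      using sum.shift_bounds_nat_ivl[of
          "\<lambda>c. gen_jordan_block p a $$ (d + i, c) * X $$ (c, j)" 0 d "?s * b"]
      by (simp add: add.commute)
    also have "\<dots> = (\<Sum>c=0..<?s * b. gen_jordan_block p b $$ (i, c) * Y $$ (c, j))"
      using ent[OF i] j by (intro sum.cong) (auto simp: Y_def)
    also have "\<dots> = (gen_jordan_block p b * Y) $$ (i, j)"
      using i j Yc by (auto simp: scalar_prod_def intro!: sum.cong)
    finally show "(gen_jordan_block p b * Y) $$ (i, j) = (Y * gen_jordan_block p b) $$ (i, j)" by simp
  qed (use Yc in auto)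
  with Yc show "Y \<in> centralizer (gen_jordan_block p b)"
    unfolding centralizer_gen_jordan_block_iff intertwines_def by (rule conjI)
qed

section \<open>The centralizer of a block diagonal matrix\<close>

lemma diag_block_mat_index:
  fixes As :: "'a :: zero mat list"
  assumes i: "i < length As" and sq: "\<forall>A \<in> set As. dim_col A = dim_row A"
    and u: "u < dim_row (As ! i)" and l: "l < sum_list (map dim_row As)"
  defines "off \<equiv> sum_list (map dim_row (take i As))"
  shows "diag_block_mat As $$ (off + u, l)
      = (if off \<le> l \<and> l < off + dim_row (As ! i) then (As ! i) $$ (u, l - off) else 0)"
    and "diag_block_mat As $$ (l, off + u)
      = (if off \<le> l \<and> l < off + dim_row (As ! i) then (As ! i) $$ (l - off, u) else 0)"
proof -
  define B C where "B = take i As" and "C = drop (Suc i) As"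
  have As: "As = B @ As ! i # C" using i by (simp add: B_def C_def id_take_nth_drop)
  have cols: "map dim_col B = map dim_row B" "map dim_col C = map dim_row C"
    "dim_col (As ! i) = dim_row (As ! i)"
    using sq i unfolding B_def C_def by (auto dest: in_set_takeD in_set_dropD)
  have off: "off = sum_list (map dim_row B)" by (simp add: off_def B_def)
  have tot: "sum_list (map dim_row As) = off + (dim_row (As ! i) + sum_list (map dim_row C))"
    by (subst As) (simp add: off)
  define D where "D = diag_block_mat (B @ As ! i # C)"
  have D: "diag_block_mat As = D" unfolding D_def using As by simp
  have "D $$ (off + u, l)
      = (if off \<le> l \<and> l < off + dim_row (As ! i) then (As ! i) $$ (u, l - off) else 0)"
    "D $$ (l, off + u)
      = (if off \<le> l \<and> l < off + dim_row (As ! i) then (As ! i) $$ (l - off, u) else 0)"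
    using u l unfolding tot D_def
    by (auto simp: diag_block_mat_append Let_def dim_diag_block_mat cols off)
  then show "diag_block_mat As $$ (off + u, l)
      = (if off \<le> l \<and> l < off + dim_row (As ! i) then (As ! i) $$ (u, l - off) else 0)"
    "diag_block_mat As $$ (l, off + u)
      = (if off \<le> l \<and> l < off + dim_row (As ! i) then (As ! i) $$ (l - off, u) else 0)"
    unfolding D .
qed

lemma gen_jordan_mat_carrier [simp]:
  "gen_jordan_mat p \<alpha> \<in> carrier_mat (degree p * sum_list \<alpha>) (degree p * sum_list \<alpha>)"
  by (rule carrier_matI)
    (simp_all add: gen_jordan_mat_def dim_diag_block_mat o_def sum_list_const_mult)

lemma sum_window:
  fixes f :: "nat \<Rightarrow> 'b :: comm_monoid_add"
  assumes "t + w \<le> n"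
  shows "(\<Sum>l=0..<n. if t \<le> l \<and> l < t + w then f l else 0) = (\<Sum>c=0..<w. f (t + c))"
proof -
  have "(\<Sum>l=0..<n. if t \<le> l \<and> l < t + w then f l else 0) = (\<Sum>l=t..<t + w. f l)"
    using assms by (intro sum.mono_neutral_cong_right) auto
  also have "\<dots> = (\<Sum>c=0..<w. f (t + c))"
    using sum.shift_bounds_nat_ivl[of f 0 t w] by (simp add: add.commute)
  finally show ?thesis .
qed

lemma segre_block_eq:
  assumes X: "X \<in> carrier_mat (s * sum_list \<alpha>) (s * sum_list \<alpha>)"
    and i: "i < length \<alpha>" and j: "j < length \<alpha>"
  shows "segre_block s \<alpha> X i j = mat (s * \<alpha> ! i) (s * \<alpha> ! j)
    (\<lambda>(u, v). X $$ (s * sum_list (take i \<alpha>) + u, s * sum_list (take j \<alpha>) + v))"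
proof -
  have le: "s * sum_list (take k \<alpha>) \<le> s * sum_list \<alpha>" for k
    using arg_cong[OF append_take_drop_id[of k \<alpha>], of sum_list] by (simp del: append_take_drop_id)
  have width: "s * sum_list (take (Suc k) \<alpha>) - s * sum_list (take k \<alpha>) = s * \<alpha> ! k"
    if "k < length \<alpha>" for k
    using that by (simp add: take_Suc_conv_app_nth add_mult_distrib2)
  have "s * sum_list (take (Suc i) \<alpha>) \<le> dim_row X" "s * sum_list (take (Suc j) \<alpha>) \<le> dim_col X"
    using X le by simp_all
  then show ?thesis
    unfolding segre_block_def width[OF i, symmetric] width[OF j, symmetric]
    by (rule submatrix_interval)
qed

text \<open>
  Because \<open>G\<close> is block diagonal, the sums for the entries of \<open>G X\<close> and \<open>X G\<close> in the block at \<open>(i, j)\<close> run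
  only over the window of \<open>G\<^sub>i\<close> and of \<open>G\<^sub>j\<close> respectively.
\<close>

lemma segre_block_intertwines:
  fixes p :: "'a :: field poly"
  assumes X: "X \<in> centralizer (gen_jordan_mat p \<alpha>)" and i: "i < length \<alpha>" and j: "j < length \<alpha>"
  shows "intertwines p (\<alpha> ! i) (\<alpha> ! j) (segre_block (degree p) \<alpha> X i j)"
proof -
  let ?s = "degree p" and ?G = "gen_jordan_mat p \<alpha>"
  let ?n = "?s * sum_list \<alpha>"
  define off where "off k = ?s * sum_list (take k \<alpha>)" for k
  have G: "?G \<in> carrier_mat ?n ?n" by simp
  have Xc: "X \<in> carrier_mat ?n ?n" and eq: "?G * X = X * ?G"
    using X G by (auto simp: centralizer_def)
  have inside: "off k + ?s * \<alpha> ! k \<le> ?n" if "k < length \<alpha>" for k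
  proof -
    have "sum_list (take (Suc k) \<alpha>) \<le> sum_list \<alpha>"
      using arg_cong[OF append_take_drop_id[of "Suc k" \<alpha>], of sum_list]
      by (simp del: append_take_drop_id)
    then show ?thesis
      using that by (simp add: off_def take_Suc_conv_app_nth flip: add_mult_distrib2)
  qed
  have dims: "sum_list (map dim_row (map (gen_jordan_block p) \<beta>)) = ?s * sum_list \<beta>" for \<beta>
    by (simp add: o_def sum_list_const_mult)
  have row: "?G $$ (off k + u, l)
      = (if off k \<le> l \<and> l < off k + ?s * \<alpha> ! k
         then gen_jordan_block p (\<alpha> ! k) $$ (u, l - off k) else 0)"
    and col: "?G $$ (l, off k + u)
      = (if off k \<le> l \<and> l < off k + ?s * \<alpha> ! k
         then gen_jordan_block p (\<alpha> ! k) $$ (l - off k, u) else 0)"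
    if "k < length \<alpha>" "u < ?s * \<alpha> ! k" "l < ?n" for k u l
    using diag_block_mat_index[of k "map (gen_jordan_block p) \<alpha>" u l] that
    unfolding take_map dims gen_jordan_mat_def by (auto simp: off_def)
  define Z where "Z = segre_block ?s \<alpha> X i j"
  have Z: "Z = mat (?s * \<alpha> ! i) (?s * \<alpha> ! j) (\<lambda>(u, v). X $$ (off i + u, off j + v))"
    unfolding Z_def off_def by (rule segre_block_eq[OF Xc i j])
  have Zc: "Z \<in> carrier_mat (?s * \<alpha> ! i) (?s * \<alpha> ! j)" by (simp add: Z)
  have "gen_jordan_block p (\<alpha> ! i) * Z = Z * gen_jordan_block p (\<alpha> ! j)"
  proof (rule eq_matI)
    fix u v assume "u < dim_row (Z * gen_jordan_block p (\<alpha> ! j))"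
      "v < dim_col (Z * gen_jordan_block p (\<alpha> ! j))"
    then have u: "u < ?s * \<alpha> ! i" and v: "v < ?s * \<alpha> ! j" using Zc by auto
    have u': "off i + u < ?n" and v': "off j + v < ?n"
      using inside[OF i] inside[OF j] u v by linarith+
    have "(?G * X) $$ (off i + u, off j + v)
        = (\<Sum>l=0..<?n. ?G $$ (off i + u, l) * X $$ (l, off j + v))"
      by (rule mult_mat_index[OF G Xc u' v'])
    also have "\<dots> = (\<Sum>l=0..<?n. if off i \<le> l \<and> l < off i + ?s * \<alpha> ! i
        then gen_jordan_block p (\<alpha> ! i) $$ (u, l - off i) * X $$ (l, off j + v) else 0)"
      using row[OF i u] by (intro sum.cong) auto
    also have "\<dots> = (\<Sum>c=0..<?s * \<alpha> ! i.
        gen_jordan_block p (\<alpha> ! i) $$ (u, c) * X $$ (off i + c, off j + v))"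
      by (subst sum_window[OF inside[OF i]]) simp
    also have "\<dots> = (gen_jordan_block p (\<alpha> ! i) * Z) $$ (u, v)"
      using u v by (auto simp: scalar_prod_def Z intro!: sum.cong)
    finally have L: "(?G * X) $$ (off i + u, off j + v) = \<dots>" .
    have "(X * ?G) $$ (off i + u, off j + v)
        = (\<Sum>l=0..<?n. X $$ (off i + u, l) * ?G $$ (l, off j + v))"
      by (rule mult_mat_index[OF Xc G u' v'])
    also have "\<dots> = (\<Sum>l=0..<?n. if off j \<le> l \<and> l < off j + ?s * \<alpha> ! j
        then X $$ (off i + u, l) * gen_jordan_block p (\<alpha> ! j) $$ (l - off j, v) else 0)"
      using col[OF j v] by (intro sum.cong) auto
    also have "\<dots> = (\<Sum>c=0..<?s * \<alpha> ! j.
        X $$ (off i + u, off j + c) * gen_jordan_block p (\<alpha> ! j) $$ (c, v))"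
      by (subst sum_window[OF inside[OF j]]) simp
    also have "\<dots> = (Z * gen_jordan_block p (\<alpha> ! j)) $$ (u, v)"
      using u v by (auto simp: scalar_prod_def Z intro!: sum.cong)
    finally show "(gen_jordan_block p (\<alpha> ! i) * Z) $$ (u, v)
        = (Z * gen_jordan_block p (\<alpha> ! j)) $$ (u, v)"
      using L eq by simp
  qed (use Zc in auto)
  with Zc show ?thesis unfolding intertwines_def Z_def by (rule conjI)
qed

theorem theorem4p12:
  fixes p :: "'a :: field poly" and \<alpha> :: "nat list" and G X :: "'a mat" and s m r r1 :: nat
  assumes "lead_coeff p = 1" and "irreducible p" and "degree p = s"
    and "length \<alpha> = m" and "sorted_wrt (\<ge>) \<alpha>" and "sum_list \<alpha> = r"
    and "G = gen_jordan_mat p \<alpha>"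
    and "char_poly G = p ^ r"
    and "is_minimal_poly G (p ^ r1)" and "r1 \<le> r"
    and "X \<in> centralizer G"
  shows "X \<in> carrier_mat (s * r) (s * r) \<and> (\<forall>i < m. \<forall>j < m.
    block_lower_triangular_toeplitz s (\<alpha> ! i) (\<alpha> ! j) (segre_block s \<alpha> X i j) \<and>
    (\<alpha> ! i = \<alpha> ! j \<longrightarrow>
       segre_block s \<alpha> X i j \<in> centralizer (gen_jordan_block p (\<alpha> ! i))) \<and>
    (\<alpha> ! i < \<alpha> ! j \<longrightarrow>
       (\<exists>Y \<in> centralizer (gen_jordan_block p (\<alpha> ! i)).
          segre_block s \<alpha> X i j = Y @\<^sub>c 0\<^sub>m (s * \<alpha> ! i) (s * (\<alpha> ! j - \<alpha> ! i)))) \<and>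
    (\<alpha> ! j < \<alpha> ! i \<longrightarrow>
       (\<exists>Y \<in> centralizer (gen_jordan_block p (\<alpha> ! j)).
          segre_block s \<alpha> X i j = 0\<^sub>m (s * (\<alpha> ! i - \<alpha> ! j)) (s * \<alpha> ! j) @\<^sub>r Y)))"
proof -
  have s: "0 < degree p"
  proof (rule ccontr)
    assume "\<not> 0 < degree p"
    then have "is_unit p" using assms(1) is_unit_iff_degree[of p] by auto
    then show False using assms(2) by (simp add: irreducible_def)
  qed
  have XG: "X \<in> centralizer (gen_jordan_mat p \<alpha>)" using assms by simp
  have dimG: "dim_row G = s * r"
    using gen_jordan_mat_carrier[of p \<alpha>] assms by (metis carrier_matD(1))
  then have "X \<in> carrier_mat (s * r) (s * r)"
    using assms by (simp add: centralizer_def)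
  moreover have "block_lower_triangular_toeplitz s (\<alpha> ! i) (\<alpha> ! j) (segre_block s \<alpha> X i j) \<and>
    (\<alpha> ! i = \<alpha> ! j \<longrightarrow>
       segre_block s \<alpha> X i j \<in> centralizer (gen_jordan_block p (\<alpha> ! i))) \<and>
    (\<alpha> ! i < \<alpha> ! j \<longrightarrow>
       (\<exists>Y \<in> centralizer (gen_jordan_block p (\<alpha> ! i)).
          segre_block s \<alpha> X i j = Y @\<^sub>c 0\<^sub>m (s * \<alpha> ! i) (s * (\<alpha> ! j - \<alpha> ! i)))) \<and>
    (\<alpha> ! j < \<alpha> ! i \<longrightarrow>
       (\<exists>Y \<in> centralizer (gen_jordan_block p (\<alpha> ! j)).
          segre_block s \<alpha> X i j = 0\<^sub>m (s * (\<alpha> ! i - \<alpha> ! j)) (s * \<alpha> ! j) @\<^sub>r Y))"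
    if "i < m" "j < m" for i j
  proof -
    have I: "intertwines p (\<alpha> ! i) (\<alpha> ! j) (segre_block s \<alpha> X i j)"
      using segre_block_intertwines[OF XG, of i j] that assms by simp
    have "segre_block s \<alpha> X i j \<in> centralizer (gen_jordan_block p (\<alpha> ! i))" if "\<alpha> ! i = \<alpha> ! j"
      using I that unfolding centralizer_gen_jordan_block_iff by simp
    then show ?thesis
      using intertwines_block_lower_triangular_toeplitz[OF assms(1) I]
        intertwines_wide[OF assms(1) s I] intertwines_tall[OF assms(1) s I]
      unfolding assms(3) by blast
  qed
  ultimately show ?thesis by blast
qed

end
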